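(* Let $A, B \in \mathbb{C}^{n\times n}$, $[a,b]$, $\gamma$, $\rho$, $m$, $r$, $L$, $M$, $N$, $V$, $\lambda_k$ and $\mathcal{V}_k$ be as in the context, and let $p \in \{0,1,\dots,2M-1\}$. Let $\mathsf{M}_p^{(N)}$, $\mathsf{M}_{p,\mathrm{in}}^{(N)}$ and $\mathsf{M}_{p,\mathrm{out}}^{(N)}$ be the $L\times L$ matrices defined in the context, and let $\tilde{\mathsf{M}}_p^{(N)} \in \mathbb{C}^{L\times L}$ be a numerical approximation of $\mathsf{M}_p^{(N)}$. Then the computable rigorous enclosure of $\mathsf{M}_{p,\mathrm{in}}^{(N)}$ is given by $$\mathsf{M}_{p,\mathrm{in}}^{(N)} \in \left\langle \mathsf{M}_{p}^{(N)},\ \left|\mathsf{M}_{p,\mathrm{out}}^{(N)}\right| \right\rangle \subset \left\langle \tilde{\mathsf{M}}_{p}^{(N)},\ \left|\mathsf{M}_{p,\mathrm{out}}^{(N)}\right| + \left|\mathsf{M}_{p}^{(N)}-\tilde{\mathsf{M}}_{p}^{(N)}\right| \right\rangle.$$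
   Context: Setting. $A = A^{\mathsf H} \in \mathbb{C}^{n\times n}$; $B = B^{\mathsf H}\in\mathbb{C}^{n\times n}$ is positive semidefinite with $r = \mathrm{rank}\, B$; the pencil $zB-A$ is regular, i.e. $\det(zB-A)$ is not identically zero. Weierstrass canonical form: there exists a nonsingular $X = [\boldsymbol{x}_1,\dots,\boldsymbol{x}_n]\in\mathbb{C}^{n\times n}$ with $X^{\mathsf H}(zB-A)X = z\mathrm{I}_0 - \Lambda$, where $\mathrm{I}_0$ is diagonal with leading $r$ diagonal entries equal to one and trailing $n-r$ diagonal entries equal to zero, and $\Lambda$ is diagonal with leading $r$ diagonal entries the eigenvalues $\lambda_1,\dots,\lambda_r\in\mathbb{R}$ of $A\boldsymbol{x}=\lambda B\boldsymbol{x}$ and trailing $n-r$ diagonal entries equal to one. Thus $\boldsymbol{x}_1,\dots,\boldsymbol{x}_r$ are appropriately scaled eigenvectors corresponding to $\lambda_1,\dots,\lambda_r$, respectively, and $\boldsymbol{x}_{r+1},\dots,\boldsymbol{x}_n$ form a basis of $\mathrm{Ker}\,B$. $[a,b]\subset\mathbb{R}$ is an interval whose endpoints are not eigenvalues; the eigenvalues (counting multiplicity) in $[a,b]$ are $\lambda_1,\dots,\lambda_m$, and $\lambda_{m+1},\dots,\lambda_r$ lie outside $[a,b]$. Put $\gamma = (b+a)/2$ and $\rho=(b-a)/2$. $L,M,N$ are positive integers (block size, order of moment, number of quadrature points), $V\in\mathbb{C}^{n\times L}$ is a matrix whose columns are linear combinations of all the eigenvectors and the basis vectors of $\mathrm{Ker}\,B$,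 and $\mathcal{V}_k = V^{\mathsf H}B\boldsymbol{x}_k\boldsymbol{x}_k^{\mathsf H}BV\in\mathbb{C}^{L\times L}$. Quadrature points: $\theta_j = \frac{2j-1}{N}\pi$, $z_j = \gamma+\rho \mathrm{e}^{\mathrm{i}\theta_j}$, $j=1,\dots,N$. The $N$-point trapezoidal approximation of the $p$th complex moment $\frac{1}{2\pi\mathrm{i}}\oint_{|z-\gamma|=\rho}(z-\gamma)^pV^{\mathsf H}B(zB-A)^{-1}BV\,\mathrm{d}z$ is $$\mathsf{M}_p^{(N)} = \frac1N\sum_{j=1}^N (\rho \mathrm{e}^{\mathrm{i}\theta_j})^{p+1}V^{\mathsf H}B(z_jB-A)^{-1}BV = \frac1N\sum_{j=1}^N(\rho \mathrm{e}^{\mathrm{i}\theta_j})^{p+1}\sum_{k=1}^r\frac{\mathcal{V}_k}{\rho \mathrm{e}^{\mathrm{i}\theta_j}-(\lambda_k-\gamma)}.$$ The parts regarding the inside and the outside of the circle are $$\mathsf{M}_{p,\mathrm{in}}^{(N)} = \sum_{k=1}^m (\lambda_k-\gamma)^p\,\frac{1}{1-\left(\frac{\lambda_k-\gamma}{\rho}\right)^N}\,\mathcal{V}_k,\qquad \mathsf{M}_{p,\mathrm{out}}^{(N)} = \sum_{k=m+1}^r (\lambda_k-\gamma)^p\,\frac{-\left(\frac{\rho}{\lambda_k-\gamma}\right)^N}{1-\left(\frac{\rho}{\lambda_k-\gamma}\right)^N}\,\mathcal{V}_k .$$ Notation. For a matrix $C=(c_{ij})$, $|C| = (|c_{ij}|)$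 entrywise. For $c\in\mathbb{C}^{L\times L}$ and an entrywise nonnegative $R\in\mathbb{R}^{L\times L}$, $\langle c,R\rangle$ denotes the interval matrix with radius $R$ centered at $c$, i.e. $\{Z\in\mathbb{C}^{L\times L} : |Z-c|\le R \text{ entrywise}\}$.
   Formalization: As printed the claim is false (signs do not match the nodes; aliasing for p ≥ N). Proved for p < N in two versions: printed nodes with the sign of each N-th power in M_in and M_out reversed, and printed M_in, M_out with nodes θ_j = 2jπ/N. *)

theory Defs
  imports
    Complex_Main
    "Jordan_Normal_Form.Schur_Decomposition"
    "Jordan_Normal_Form.Gauss_Jordan_Elimination"
    "Jordan_Normal_Form.DL_Rank"
begin

definition hermitian_mat :: "complex mat \<Rightarrow> bool" where
  "hermitian_mat A \<longleftrightarrow> square_mat A \<and> mat_adjoint A = A"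

definition psd_mat :: "complex mat \<Rightarrow> bool" where
  "psd_mat B \<longleftrightarrow> hermitian_mat B \<and>
     (\<forall>v \<in> carrier_vec (dim_row B). 0 \<le> Re ((B *\<^sub>v v) \<bullet>c v))"

definition pencil :: "complex mat \<Rightarrow> complex mat \<Rightarrow> complex \<Rightarrow> complex mat" where
  "pencil A B z = z \<cdot>\<^sub>m B - A"

definition regular_pencil :: "complex mat \<Rightarrow> complex mat \<Rightarrow> bool" where
  "regular_pencil A B \<longleftrightarrow> (\<exists>z. det (pencil A B z) \<noteq> 0)"

definition gen_eigenvalue :: "complex mat \<Rightarrow> complex mat \<Rightarrow> complex \<Rightarrow> bool" where
  "gen_eigenvalue A B z \<longleftrightarrow>
     (\<exists>x \<in> carrier_vec (dim_row A). x \<noteq> 0\<^sub>v (dim_row A) \<and> A *\<^sub>v x = z \<cdot>\<^sub>v (B *\<^sub>v x))"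

(* Indices of the eigenvalues and of the columns of X run from 0, so that
   lam 0, ..., lam (r - 1) and col X 0, ..., col X (n - 1) are the objects usually
   numbered 1, ..., r and 1, ..., n. *)
definition weierstrass_form ::
  "nat \<Rightarrow> nat \<Rightarrow> complex mat \<Rightarrow> complex mat \<Rightarrow> complex mat \<Rightarrow> (nat \<Rightarrow> real) \<Rightarrow> bool" where
  "weierstrass_form n r A B X lam \<longleftrightarrow>
     X \<in> carrier_mat n n \<and> invertible_mat X \<and>
     (\<forall>z. mat_adjoint X * pencil A B z * X =
            z \<cdot>\<^sub>m mat_diag n (\<lambda>k. if k < r then 1 else 0)
              - mat_diag n (\<lambda>k. if k < r then complex_of_real (lam k) else 1))"

definition eig_part :: "complex mat \<Rightarrow> complex mat \<Rightarrow> complex mat \<Rightarrow> nat \<Rightarrow> complex mat" where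
  "eig_part B V X k =
     (let x = mat_of_cols (dim_row X) [col X k]
      in mat_adjoint V * B * x * mat_adjoint x * B * V)"

(* Quadrature angles.  s = 1 gives the half-step nodes (2 j - 1) pi / N, and s = 0
   gives the nodes 2 j pi / N.  With w = rho exp (i theta_j) one has
   w ^ N = (-1) ^ s * rho ^ N; this sign reappears in moment_in and moment_out. *)
definition quad_angle :: "nat \<Rightarrow> nat \<Rightarrow> nat \<Rightarrow> real" where
  "quad_angle s N j = (2 * real j - real s) / real N * pi"

definition moment ::
  "nat \<Rightarrow> complex mat \<Rightarrow> complex mat \<Rightarrow> complex mat \<Rightarrow> real \<Rightarrow> real \<Rightarrow> nat \<Rightarrow> nat \<Rightarrow> complex mat" where
  "moment s A B V \<gamma> \<rho> N p = mat (dim_col V) (dim_col V) (\<lambda>(i, l).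
     1 / of_nat N * (\<Sum>j = 1..N.
       let w = complex_of_real \<rho> * cis (quad_angle s N j);
           z = complex_of_real \<gamma> + w
       in w ^ (p + 1) *
          (mat_adjoint V * B * the (mat_inverse (pencil A B z)) * B * V) $$ (i, l)))"

(* For s = 0 the denominators are 1 - (...) ^ N and the numerator of moment_out is
   - (...) ^ N; for s = 1 the N-th powers change sign, because (-1) ^ s = -1. *)
definition moment_in ::
  "nat \<Rightarrow> complex mat \<Rightarrow> complex mat \<Rightarrow> complex mat \<Rightarrow> (nat \<Rightarrow> real) \<Rightarrow> nat \<Rightarrow>
   real \<Rightarrow> real \<Rightarrow> nat \<Rightarrow> nat \<Rightarrow> complex mat" where
  "moment_in s B V X lam m \<gamma> \<rho> N p = mat (dim_col V) (dim_col V) (\<lambda>(i, l).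
     \<Sum>k = 0..<m. complex_of_real
       ((lam k - \<gamma>) ^ p * (1 / (1 - (-1) ^ s * ((lam k - \<gamma>) / \<rho>) ^ N)))
       * eig_part B V X k $$ (i, l))"

definition moment_out ::
  "nat \<Rightarrow> complex mat \<Rightarrow> complex mat \<Rightarrow> complex mat \<Rightarrow> (nat \<Rightarrow> real) \<Rightarrow> nat \<Rightarrow> nat \<Rightarrow>
   real \<Rightarrow> real \<Rightarrow> nat \<Rightarrow> nat \<Rightarrow> complex mat" where
  "moment_out s B V X lam m r \<gamma> \<rho> N p = mat (dim_col V) (dim_col V) (\<lambda>(i, l).
     \<Sum>k = m..<r. complex_of_real
       ((lam k - \<gamma>) ^ p *
        (- ((-1) ^ s * (\<rho> / (lam k - \<gamma>)) ^ N) / (1 - (-1) ^ s * (\<rho> / (lam k - \<gamma>)) ^ N)))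
       * eig_part B V X k $$ (i, l))"

definition abs_mat :: "complex mat \<Rightarrow> real mat" where
  "abs_mat C = map_mat cmod C"

definition interval_mat :: "complex mat \<Rightarrow> real mat \<Rightarrow> complex mat set" where
  "interval_mat C R = {Z \<in> carrier_mat (dim_row C) (dim_col C).
     \<forall>i < dim_row C. \<forall>l < dim_col C. abs_mat (Z - C) $$ (i, l) \<le> R $$ (i, l)}"

end

theory Submission
  imports Defs
begin

text \<open>Congruence by \<open>X\<close> diagonalises the resolvent, so each entry of the quadrature sum is a
combination of the scalar sums of \<open>w ^ (p + 1) / (w - c)\<close> with \<open>c = \<lambda>\<^sub>k - \<gamma>\<close>. At the nodes
\<open>w ^ N = \<sigma> * \<rho> ^ N\<close> with \<open>\<sigma> = (-1) ^ s\<close>, hence \<open>1 / (w - c)\<close> is a polynomial in \<open>w\<close> divided by the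
constant \<open>\<sigma> * \<rho> ^ N - c ^ N\<close>, and discrete orthogonality of the powers of \<open>w\<close> leaves only
\<open>\<sigma> * \<rho> ^ N * c ^ p / (\<sigma> * \<rho> ^ N - c ^ N)\<close>; here \<open>p < N\<close> enters. So the moment is exactly the sum
of its inside and outside parts, and the enclosures are triangle inequalities.\<close>

section \<open>Power sums over the quadrature nodes\<close>

lemma cis_quad_angle_power_N:
  assumes "0 < N"
  shows "cis (quad_angle s N j) ^ N = (- 1) ^ s"
proof -
  have "real N * quad_angle s N j = 2 * pi * real j - real s * pi"
    using assms by (simp add: quad_angle_def left_diff_distrib)
  hence "cis (quad_angle s N j) ^ N = cis (2 * pi * real j - real s * pi)"
    by (simp only: DeMoivre)
  also have "\<dots> = cis (2 * pi * real j) / cis (real s * pi)"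
    by (simp only: cis_divide)
  also have "cis (real s * pi) = cis pi ^ s"
    by (simp only: DeMoivre)
  finally show ?thesis
    by (cases "even s") simp_all
qed

lemma cis_eq_one_iff: "cis x = 1 \<longleftrightarrow> (\<exists>k::int. x = k * 2 * pi)"
proof
  assume "cis x = 1"
  hence "cos x = 1" by (metis cis.sel(1) one_complex.sel(1))
  thus "\<exists>k::int. x = k * 2 * pi" by (simp add: cos_one_2pi_int)
next
  assume "\<exists>k::int. x = k * 2 * pi"
  then obtain k :: int where "x = 2 * pi * k" by auto
  thus "cis x = 1" by simp
qed

text \<open>The summands form a geometric progression whose ratio \<open>h\<close> is an
  \<open>N\<close>-th root of unity, so the sum vanishes unless \<open>N\<close> divides
  \<open>q\<close>. Below \<open>2 * N\<close> the only positive multiple of \<open>N\<close> is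
  \<open>N\<close> itself; this range covers the exponents \<open>p + 1 + q\<close> with
  \<open>p, q < N\<close> that occur in the quadrature.\<close>

lemma sum_cis_quad_angle_power:
  assumes N: "0 < N" and q: "0 < q" "q < 2 * N"
  shows "(\<Sum>j = 1..N. cis (quad_angle s N j) ^ q) = (if q = N then of_nat N * (- 1) ^ s else 0)"
proof (cases "q = N")
  case True
  thus ?thesis using cis_quad_angle_power_N[OF N] by simp
next
  case False
  define h where "h = cis (2 * pi * real q / real N)"
  \<comment> \<open>The shift of the angles by \<open>s\<close> contributes only this phase, which
    does not depend on \<open>j\<close>.\<close>
  define c where "c = cis (- (real s * real q * pi / real N))"
  have pow: "cis (quad_angle s N j) ^ q = c * h ^ j" for j
    unfolding h_def c_def DeMoivre cis_mult quad_angle_def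
    by (rule arg_cong[of _ _ cis]) (use N in \<open>simp add: field_simps\<close>)
  have hN: "h ^ N = 1"
    unfolding h_def DeMoivre using N by simp
  have h1: "h \<noteq> 1"
  proof
    assume "h = 1"
    then obtain k :: int where "2 * pi * real q / real N = of_int k * 2 * pi"
      unfolding h_def cis_eq_one_iff by blast
    hence "real q = real_of_int k * real N" using N by (simp add: field_simps)
    hence k: "int q = k * int N"
      by (metis of_int_eq_iff of_int_mult of_int_of_nat_eq)
    have "0 < k" using k q N
      by (metis mult_nonpos_nonneg not_less of_nat_0_le_iff of_nat_0_less_iff)
    moreover have "k * int N < 2 * int N" using k q by linarith
    hence "k < 2" using N by simp
    ultimately have "k = 1" by linarith
    thus False using k False by simp
  qed
  \<comment> \<open>The nodes are numbered from 1, so one factor \<open>h\<close> is split off to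
    reach the standard geometric sum.\<close>
  have "(\<Sum>j = 1..N. h ^ j) = h * (\<Sum>j<N. h ^ j)"
    by (simp add: sum_distrib_left sum.atLeast1_atMost_eq)
  also have "\<dots> = 0" using h1 hN by (simp add: geometric_sum)
  finally show ?thesis using False by (simp add: pow flip: sum_distrib_left)
qed

text \<open>The value is \<open>c ^ p\<close> times the filter function of the trapezoidal rule. The
  hypothesis on \<open>c\<close> keeps the common denominator nonzero and thereby keeps
  \<open>c\<close> away from every node.\<close>

lemma quadrature_sum:
  fixes c :: complex and \<rho> :: real
  assumes N: "0 < N" and p: "p < N"
    and c: "c ^ N \<noteq> (- 1) ^ s * of_real \<rho> ^ N"
  defines "w \<equiv> \<lambda>j. of_real \<rho> * cis (quad_angle s N j)"
  shows "(\<Sum>j = 1..N. w j ^ (p + 1) / (w j - c)) / of_nat N =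
    (- 1) ^ s * of_real \<rho> ^ N * c ^ p / ((- 1) ^ s * of_real \<rho> ^ N - c ^ N)"
proof -
  define d where "d = (- 1) ^ s * of_real \<rho> ^ N - c ^ N"
  have d: "d \<noteq> 0" using c by (auto simp: d_def)
  have wN: "w j ^ N = (- 1) ^ s * of_real \<rho> ^ N" for j
    by (simp add: w_def power_mult_distrib cis_quad_angle_power_N[OF N])
  have summand: "w j ^ (p + 1) / (w j - c) = (\<Sum>q<N. w j ^ (p + 1 + q) * c ^ (N - Suc q)) / d" for j
  proof -
    \<comment> \<open>Since \<open>w j ^ N\<close> is the same at all nodes, one \<open>d\<close>
      serves the whole sum.\<close>
    have d_eq: "d = (w j - c) * (\<Sum>q<N. w j ^ q * c ^ (N - Suc q))"
      (is "_ = _ * ?S") unfolding d_def wN[of j, symmetric]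
      by (simp add: power_diff_sumr2 mult.commute)
    have "w j - c \<noteq> 0" "?S \<noteq> 0" using d unfolding d_eq by auto
    hence "w j ^ (p + 1) / (w j - c) = w j ^ (p + 1) * ?S / d"
      unfolding d_eq by simp
    thus ?thesis by (simp only: sum_distrib_left power_add mult.assoc)
  qed
  have orth: "(\<Sum>j = 1..N. w j ^ (p + 1 + q)) =
      (if q = N - 1 - p then of_nat N * (- 1) ^ s * of_real \<rho> ^ N else 0)" if "q < N" for q
  proof -
    have "(\<Sum>j = 1..N. w j ^ (p + 1 + q)) =
        of_real \<rho> ^ (p + 1 + q) * (\<Sum>j = 1..N. cis (quad_angle s N j) ^ (p + 1 + q))"
      unfolding w_def power_mult_distrib by (simp only: sum_distrib_left)
    moreover have "p + 1 + q = N \<longleftrightarrow> q = N - 1 - p" using p by auto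
    ultimately show ?thesis
      using sum_cis_quad_angle_power[OF N, of "p + 1 + q" s] p that
      by (simp only: if_distrib) (auto simp del: power_Suc)
  qed
  have "(\<Sum>j = 1..N. w j ^ (p + 1) / (w j - c)) =
      (\<Sum>q<N. (\<Sum>j = 1..N. w j ^ (p + 1 + q)) * c ^ (N - Suc q)) / d"
    unfolding summand sum_divide_distrib[symmetric] sum_distrib_right
    by (subst sum.swap) (rule refl)
  also have "\<dots> = (\<Sum>q<N. if q = N - 1 - p
      then of_nat N * (- 1) ^ s * of_real \<rho> ^ N * c ^ (N - Suc q) else 0) / d"
    by (intro arg_cong2[where f = "(/)"] sum.cong refl)
      (simp only: lessThan_iff orth mult_zero_left split: if_split, simp)
  \<comment> \<open>The surviving index \<open>q = N - 1 - p\<close> lies in the range because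
    \<open>p < N\<close>, and there \<open>N - Suc q = p\<close>.\<close>
  also have "\<dots> = of_nat N * (- 1) ^ s * of_real \<rho> ^ N * c ^ p / d"
    using N p by (simp add: sum.delta)
  finally show ?thesis using N by (simp add: d_def)
qed

section \<open>Matrix products and the rank-one eigenvector terms\<close>

lemma assoc_mult_mat_4:
  fixes A :: "'a :: semiring_0 mat"
  assumes A: "A \<in> carrier_mat n1 n2" and B: "B \<in> carrier_mat n2 n3"
    and C: "C \<in> carrier_mat n3 n4" and D: "D \<in> carrier_mat n4 n5"
  shows "A * B * C * D = A * (B * C * D)"
proof -
  have "A * B * C * D = A * (B * C) * D"
    by (simp only: assoc_mult_mat[OF A B C])
  also have "\<dots> = A * (B * C * D)"
    by (rule assoc_mult_mat[OF A mult_carrier_mat[OF B C] D])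
  finally show ?thesis .
qed

lemma mult_mat_zero_vec:
  fixes A :: "'a :: semiring_0 mat"
  shows "A \<in> carrier_mat m n \<Longrightarrow> A *\<^sub>v 0\<^sub>v n = 0\<^sub>v m"
  by auto

lemma mat_adjoint_carrier:
  "A \<in> carrier_mat n m \<Longrightarrow> mat_adjoint A \<in> carrier_mat m n"
  by (auto simp: mat_adjoint_def)

lemma mat_adjoint_mat_of_cols_col:
  assumes "X \<in> carrier_mat n n'" "k < n'"
  shows "mat_adjoint (mat_of_cols n [col X k]) = mat 1 n (\<lambda>(i, l). mat_adjoint X $$ (k, l))"
  using assms by (intro eq_matI) (auto simp: mat_adjoint_def mat_of_rows_def mat_of_cols_def)

text \<open>The product is split at the inner dimension 1, between \<open>x\<close> and its adjoint:
  it is an outer product, so each entry is a product of two entries. In this form it can be matched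
  with the terms of a product with a diagonal middle factor.\<close>

lemma eig_part_index:
  assumes B: "B \<in> carrier_mat n n" and X: "X \<in> carrier_mat n n" and V: "V \<in> carrier_mat n L"
    and k: "k < n" and il: "i < L" "l < L"
  shows "eig_part B V X k $$ (i, l) =
    (mat_adjoint V * B * X) $$ (i, k) * (mat_adjoint X * B * V) $$ (k, l)"
proof -
  let ?x = "mat_of_cols n [col X k]"
  let ?V = "mat_adjoint V" and ?xh = "mat_adjoint ?x"
  have x: "?x \<in> carrier_mat n 1" by auto
  have c: "?V \<in> carrier_mat L n" "?xh \<in> carrier_mat 1 n" "mat_adjoint X \<in> carrier_mat n n"
    using V x X by (auto intro!: mat_adjoint_carrier)
  note carr = B X V x c
  have "eig_part B V X k = ?V * B * ?x * (?xh * B * V)"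
  proof -
    have "?V * B * ?x \<in> carrier_mat L 1"
      using c B x by auto
    hence "?V * B * ?x * ?xh * B * V = ?V * B * ?x * (?xh * B * V)"
      using c(2) B V by (rule assoc_mult_mat_4)
    thus ?thesis using X by (simp add: eig_part_def Let_def)
  qed
  also have "\<dots> $$ (i, l) = (?V * B * ?x) $$ (i, 0) * (?xh * B * V) $$ (0, l)"
    using carr il by (simp add: scalar_prod_def)
  also have "(?V * B * ?x) $$ (i, 0) = (?V * B * X) $$ (i, k)"
    using carr il k by (simp del: assoc_mult_mat)
  also have "(?xh * B * V) $$ (0, l) = (mat_adjoint X * B * V) $$ (k, l)"
    using carr il k unfolding mat_adjoint_mat_of_cols_col[OF X k]
    by (auto simp: scalar_prod_def simp del: assoc_mult_mat intro!: sum.cong)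
  finally show ?thesis .
qed

section \<open>The Weierstrass form, the resolvent and the spectrum\<close>

locale weierstrass_pencil =
  fixes n r :: nat and A B X :: "complex mat" and lam :: "nat \<Rightarrow> real"
  assumes A: "A \<in> carrier_mat n n" and B: "B \<in> carrier_mat n n"
    and weierstrass: "weierstrass_form n r A B X lam"
    and r_le: "r \<le> n"
begin

lemma X: "X \<in> carrier_mat n n"
  using weierstrass by (simp add: weierstrass_form_def)

lemma XH: "mat_adjoint X \<in> carrier_mat n n"
  using X by (rule mat_adjoint_carrier)

lemma pencil_carrier: "pencil A B z \<in> carrier_mat n n"
  using A B by (auto simp: pencil_def)

lemma congruence_pencil:
  "mat_adjoint X * pencil A B z * X =
    mat_diag n (\<lambda>k. if k < r then z - of_real (lam k) else - 1)"
proof -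
  have "mat_adjoint X * pencil A B z * X =
      z \<cdot>\<^sub>m mat_diag n (\<lambda>k. if k < r then 1 else 0)
        - mat_diag n (\<lambda>k. if k < r then complex_of_real (lam k) else 1)"
    using weierstrass unfolding weierstrass_form_def by blast
  thus ?thesis by (auto simp: mat_diag_def)
qed

text \<open>\<open>B\<close> is the difference of the pencils at 1 and at 0, so its congruence is a
  difference of two known diagonal matrices.\<close>

lemma congruence_B:
  "mat_adjoint X * B * X = mat_diag n (\<lambda>k. if k < r then 1 else 0)"
proof -
  have split: "pencil A B 1 = pencil A B 0 + B"
    using A B by (auto simp: pencil_def)
  have "mat_adjoint X * pencil A B 1 * X = mat_adjoint X * pencil A B 0 * X + mat_adjoint X * B * X"
    using XH pencil_carrier[of 0] B X unfolding split
    by (simp add: mult_add_distrib_mat[of _ n n _ n] add_mult_distrib_mat[of _ n n _ _ n])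
  hence eq: "mat_diag n (\<lambda>k. if k < r then 1 - of_real (lam k) else - 1) =
      mat_diag n (\<lambda>k. if k < r then 0 - of_real (lam k) else - 1) + mat_adjoint X * B * X"
    unfolding congruence_pencil .
  show ?thesis
  proof (rule eq_matI)
    fix i j assume "i < dim_row (mat_diag n (\<lambda>k. if k < r then 1 else 0 :: complex))"
      "j < dim_col (mat_diag n (\<lambda>k. if k < r then 1 else 0 :: complex))"
    hence ij: "i < n" "j < n" by (auto simp: mat_diag_def)
    from arg_cong[OF eq, of "\<lambda>D. D $$ (i, j)"] ij XH X
    show "(mat_adjoint X * B * X) $$ (i, j) = mat_diag n (\<lambda>k. if k < r then 1 else 0) $$ (i, j)"
      by (auto simp: mat_diag_def split: if_splits)
  qed (use XH X in \<open>auto simp: mat_diag_def\<close>)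
qed

text \<open>Obtained by formally inverting the diagonal congruence; the trailing entries
  \<open>- 1\<close> are their own inverses. At an eigenvalue the quotient takes the default value
  0, so the inverse property is only claimed away from the \<open>lam k\<close>.\<close>

definition resolvent :: "complex \<Rightarrow> complex mat" where
  "resolvent z = X * mat_diag n (\<lambda>k. if k < r then 1 / (z - of_real (lam k)) else - 1) * mat_adjoint X"

lemma resolvent_carrier: "resolvent z \<in> carrier_mat n n"
  using X XH by (auto simp: resolvent_def)

lemma XH_right_inverse:
  assumes z: "\<And>k. k < r \<Longrightarrow> z \<noteq> of_real (lam k)"
  shows "mat_adjoint X *
    (pencil A B z * X * mat_diag n (\<lambda>k. if k < r then 1 / (z - of_real (lam k)) else - 1)) = 1\<^sub>m n"
    (is "_ * (_ * _ * ?D) = _")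
proof -
  have "mat_adjoint X * (pencil A B z * X * ?D) = mat_adjoint X * pencil A B z * X * ?D"
    using XH X pencil_carrier[of z] mat_diag_dim
    by (simp add: assoc_mult_mat[of _ n n _ n _ n])
  also have "\<dots> = mat_diag n (\<lambda>k. 1)"
    unfolding congruence_pencil mat_diag_diag
    by (auto simp: mat_diag_def z)
  finally show ?thesis by simp
qed

text \<open>For square matrices a right inverse is also a left inverse, so the factor
  \<open>mat_adjoint X\<close> in \<open>XH_right_inverse\<close> may be moved to the other end of
  the product.\<close>

lemma pencil_resolvent:
  assumes z: "\<And>k. k < r \<Longrightarrow> z \<noteq> of_real (lam k)"
  shows "pencil A B z * resolvent z = 1\<^sub>m n"
proof -
  let ?D = "mat_diag n (\<lambda>k. if k < r then 1 / (z - of_real (lam k)) else - 1)"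
  have Y: "pencil A B z * X * ?D \<in> carrier_mat n n"
    by (rule mult_carrier_mat[OF mult_carrier_mat[OF pencil_carrier X] mat_diag_dim])
  have "pencil A B z * X * ?D * mat_adjoint X = 1\<^sub>m n"
    using mat_mult_left_right_inverse[OF XH Y XH_right_inverse[OF z]] .
  thus ?thesis
    using XH X pencil_carrier[of z] mat_diag_dim unfolding resolvent_def
    by (simp add: assoc_mult_mat[of _ n n _ n _ n])
qed

text \<open>A two-sided inverse makes the pencil a unit, which excludes the result
  \<open>None\<close>; uniqueness of inverses then identifies the computed matrix.\<close>

lemma mat_inverse_pencil:
  assumes z: "\<And>k. k < r \<Longrightarrow> z \<noteq> of_real (lam k)"
  shows "the (mat_inverse (pencil A B z)) = resolvent z"
proof -
  let ?P = "pencil A B z"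
  note PR = pencil_resolvent[OF z]
  have RP: "resolvent z * ?P = 1\<^sub>m n"
    by (rule mat_mult_left_right_inverse[OF pencil_carrier resolvent_carrier PR])
  have "?P \<in> Units (ring_mat TYPE(complex) n undefined)"
    using PR RP pencil_carrier resolvent_carrier unfolding Units_def ring_mat_def by auto
  then obtain Q where Q: "mat_inverse ?P = Some Q"
    using mat_inverse(1)[OF pencil_carrier] by fastforce
  from mat_inverse(2)[OF pencil_carrier this]
  have Q': "?P * Q = 1\<^sub>m n" "Q \<in> carrier_mat n n" by auto
  have "Q = resolvent z * ?P * Q" using RP Q' by simp
  also have "\<dots> = resolvent z * (?P * Q)"
    using assoc_mult_mat[OF resolvent_carrier pencil_carrier Q'(2)] .
  also have "\<dots> = resolvent z"
    using Q' right_mult_one_mat[OF resolvent_carrier] by simp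
  finally show ?thesis using Q by simp
qed

lemma XH_left_inverse:
  obtains Y where "Y \<in> carrier_mat n n" "Y * mat_adjoint X = 1\<^sub>m n"
proof -
  have "finite ((\<lambda>k. complex_of_real (lam k)) ` {..<r})" by simp
  then obtain z where "z \<notin> (\<lambda>k. complex_of_real (lam k)) ` {..<r}"
    using ex_new_if_finite[OF infinite_UNIV_char_0] by blast
  hence z: "\<And>k. k < r \<Longrightarrow> z \<noteq> of_real (lam k)" by auto
  let ?Y = "pencil A B z * X * mat_diag n (\<lambda>k. if k < r then 1 / (z - of_real (lam k)) else - 1)"
  have Y: "?Y \<in> carrier_mat n n" by (rule mult_carrier_mat[OF mult_carrier_mat[OF pencil_carrier X] mat_diag_dim])
  show thesis
    using that[OF Y] mat_mult_left_right_inverse[OF XH Y XH_right_inverse[OF z]] by blast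
qed

text \<open>At \<open>z = 1 + lam k\<close> the \<open>k\<close>-th diagonal entry of the congruence
  is 1 or \<open>- 1\<close>, whereas a zero column of \<open>X\<close> would make it 0.\<close>

lemma col_X_nonzero:
  assumes k: "k < n"
  shows "col X k \<noteq> 0\<^sub>v n"
proof
  assume 0: "col X k = 0\<^sub>v n"
  have XP: "mat_adjoint X * pencil A B (1 + of_real (lam k)) \<in> carrier_mat n n"
    by (rule mult_carrier_mat[OF XH pencil_carrier])
  have "col (mat_adjoint X * pencil A B (1 + of_real (lam k)) * X) k = 0\<^sub>v n"
    unfolding col_mult2[OF XP X k] 0 by (rule mult_mat_zero_vec[OF XP])
  from arg_cong[OF this, of "\<lambda>v. v $ k"] k show False
    unfolding congruence_pencil by (auto simp: mat_diag_def split: if_splits)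
qed

text \<open>Column \<open>k\<close> of the congruence vanishes at \<open>z = lam k\<close>, and
  cancelling \<open>mat_adjoint X\<close> leaves a kernel vector of the pencil. This turns the
  assumption on the endpoints of the interval into a statement about the numbers
  \<open>lam k\<close>.\<close>

lemma gen_eigenvalue_lam:
  assumes k: "k < r"
  shows "gen_eigenvalue A B (of_real (lam k))"
proof -
  let ?x = "col X k" and ?P = "pencil A B (of_real (lam k))"
  have kn: "k < n" using k r_le by simp
  have x: "?x \<in> carrier_vec n" using X by auto
  have Px: "?P *\<^sub>v ?x \<in> carrier_vec n" by (rule mult_mat_vec_carrier[OF pencil_carrier x])
  have XP: "mat_adjoint X * ?P \<in> carrier_mat n n" by (rule mult_carrier_mat[OF XH pencil_carrier])
  have "mat_adjoint X *\<^sub>v (?P *\<^sub>v ?x) = col (mat_adjoint X * ?P * X) k"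
    using col_mult2[OF XP X kn] XH pencil_carrier x by (simp add: assoc_mult_mat_vec[of _ n n _ n])
  also have "\<dots> = 0\<^sub>v n"
    unfolding congruence_pencil using k kn by (auto simp: mat_diag_def)
  finally have XPx: "mat_adjoint X *\<^sub>v (?P *\<^sub>v ?x) = 0\<^sub>v n" .
  obtain Y where Y: "Y \<in> carrier_mat n n" "Y * mat_adjoint X = 1\<^sub>m n"
    by (rule XH_left_inverse)
  have "?P *\<^sub>v ?x = Y * mat_adjoint X *\<^sub>v (?P *\<^sub>v ?x)" using Y Px by simp
  also have "\<dots> = Y *\<^sub>v 0\<^sub>v n"
    unfolding assoc_mult_mat_vec[OF Y(1) XH Px] XPx ..
  also have "\<dots> = 0\<^sub>v n" using Y(1) by (rule mult_mat_zero_vec)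
  finally have Px0: "?P *\<^sub>v ?x = 0\<^sub>v n" .
  have "(of_real (lam k) \<cdot>\<^sub>v (B *\<^sub>v ?x)) $ i - (A *\<^sub>v ?x) $ i = (?P *\<^sub>v ?x) $ i" if "i < n" for i
  proof -
    have dim: "dim_row X = n" using X by simp
    show ?thesis
      using that A B
      by (simp add: pencil_def scalar_prod_def dim sum_distrib_left left_diff_distrib mult.assoc
          flip: sum_subtractf)
  qed
  hence "(of_real (lam k) \<cdot>\<^sub>v (B *\<^sub>v ?x)) $ i = (A *\<^sub>v ?x) $ i" if "i < n" for i
    using that unfolding Px0 by simp
  hence "A *\<^sub>v ?x = of_real (lam k) \<cdot>\<^sub>v (B *\<^sub>v ?x)"
    using A B x by (intro eq_vecI) auto
  thus ?thesis
    unfolding gen_eigenvalue_def using A x col_X_nonzero[OF kn] by auto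
qed

text \<open>Absorbing the outer factors of the resolvent into \<open>P\<close> and \<open>Q\<close>
  leaves a diagonal matrix between them, hence a sum of partial fractions over
  \<open>k\<close>.\<close>

lemma sandwiched_resolvent_index:
  assumes C: "C \<in> carrier_mat n L" and V: "V = X * C"
    and z: "\<And>k. k < r \<Longrightarrow> z \<noteq> of_real (lam k)"
    and il: "i < L" "l < L"
  shows "(mat_adjoint V * B * the (mat_inverse (pencil A B z)) * B * V) $$ (i, l) =
    (\<Sum>k<r. eig_part B V X k $$ (i, l) / (z - of_real (lam k)))"
proof -
  let ?d = "\<lambda>k. if k < r then 1 / (z - of_real (lam k)) else - 1"
  have Vc: "V \<in> carrier_mat n L" using V X C by auto
  have VH: "mat_adjoint V \<in> carrier_mat L n" using Vc by (rule mat_adjoint_carrier)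
  define P where "P = mat_adjoint V * B * X"
  define Q where "Q = mat_adjoint X * B * V"
  have P: "P \<in> carrier_mat L n" using VH B X by (simp add: P_def)
  have Q: "Q \<in> carrier_mat n L" using XH B Vc by (simp add: Q_def)
  have inv: "the (mat_inverse (pencil A B z)) = resolvent z"
    using z by (rule mat_inverse_pencil)
  have W: "mat_adjoint V * B \<in> carrier_mat L n" using VH B by (rule mult_carrier_mat)
  have PD: "P * mat_diag n ?d \<in> carrier_mat L n" using P mat_diag_dim by (rule mult_carrier_mat)
  have "mat_adjoint V * B * the (mat_inverse (pencil A B z)) * B * V =
      P * mat_diag n ?d * mat_adjoint X * B * V"
    unfolding inv resolvent_def P_def assoc_mult_mat_4[OF W X mat_diag_dim XH] ..
  also have "\<dots> = P * mat_diag n ?d * Q"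
    unfolding Q_def using PD XH B Vc by (rule assoc_mult_mat_4)
  also have "\<dots> $$ (i, l) = (\<Sum>k<n. P $$ (i, k) * ?d k * Q $$ (k, l))"
    unfolding mat_diag_mult_right[OF P] using P Q il
    by (simp add: scalar_prod_def lessThan_atLeast0)
  also have "\<dots> = (\<Sum>k<r. P $$ (i, k) * ?d k * Q $$ (k, l))"
  proof (rule sum.mono_neutral_right)
    \<comment> \<open>The expansion of \<open>V\<close> in the columns of \<open>X\<close> enters
      here: the directions in the kernel of \<open>B\<close> give zero rows of \<open>Q\<close>, so
      only \<open>k < r\<close> contributes.\<close>
    have "Q = mat_adjoint X * B * X * C"
      unfolding Q_def V using XH B X C
      by (simp add: assoc_mult_mat[of _ n n _ n _ L])
    hence "Q = mat_diag n (\<lambda>k. if k < r then 1 else 0) * C"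
      by (simp only: congruence_B)
    hence "Q $$ (k, l) = 0" if "r \<le> k" "k < n" for k
      using that il C by (simp add: mat_diag_mult_left[OF C])
    thus "\<forall>k\<in>{..<n} - {..<r}. P $$ (i, k) * ?d k * Q $$ (k, l) = 0" by auto
  qed (use r_le in auto)
  also have "\<dots> = (\<Sum>k<r. eig_part B V X k $$ (i, l) / (z - of_real (lam k)))"
    using r_le eig_part_index[OF B X Vc _ il] by (intro sum.cong) (auto simp: P_def Q_def)
  finally show ?thesis .
qed

text \<open>Exchanging the sums over nodes and eigenvalues reduces the claim to
  \<open>quadrature_sum\<close> at \<open>c k\<close>. Comparing moduli, \<open>off_circle\<close>
  is used twice: no node is an eigenvalue, and no denominator of the filter vanishes.\<close>

lemma moment_index:
  assumes C: "C \<in> carrier_mat n L" and V: "V = X * C"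
    and N: "0 < N" and p: "p < N"
    and off_circle: "\<And>k. k < r \<Longrightarrow> \<bar>lam k - \<gamma>\<bar> \<noteq> \<bar>\<rho>\<bar>"
    and il: "i < L" "l < L"
  shows "moment s A B V \<gamma> \<rho> N p $$ (i, l) =
    (\<Sum>k<r. of_real ((- 1) ^ s * \<rho> ^ N * (lam k - \<gamma>) ^ p / ((- 1) ^ s * \<rho> ^ N - (lam k - \<gamma>) ^ N))
      * eig_part B V X k $$ (i, l))"
proof -
  define w where "w j = of_real \<rho> * cis (quad_angle s N j)" for j
  define E where "E k = eig_part B V X k $$ (i, l)" for k
  define c where "c k = complex_of_real (lam k - \<gamma>)" for k
  have dim: "dim_col V = L" using V C by simp
  have z: "of_real \<gamma> + w j \<noteq> of_real (lam k)" if "k < r" for k j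
  proof
    assume "of_real \<gamma> + w j = of_real (lam k)"
    hence "c k = w j" by (simp add: c_def algebra_simps)
    hence "cmod (c k) = cmod (w j)" by simp
    thus False using off_circle[OF that] by (simp add: w_def c_def norm_mult del: of_real_diff)
  qed
  have pow: "c k ^ N \<noteq> (- 1) ^ s * of_real \<rho> ^ N" if "k < r" for k
  proof
    assume "c k ^ N = (- 1) ^ s * of_real \<rho> ^ N"
    hence "cmod (c k ^ N) = cmod ((- 1) ^ s * of_real \<rho> ^ N)" by simp
    hence "\<bar>lam k - \<gamma>\<bar> ^ N = \<bar>\<rho>\<bar> ^ N"
      by (simp add: c_def norm_mult norm_power del: of_real_diff)
    thus False using off_circle[OF that] N power_eq_iff_eq_base by (metis abs_ge_zero)
  qed
  have "moment s A B V \<gamma> \<rho> N p $$ (i, l) =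
      (\<Sum>j = 1..N. w j ^ (p + 1) * (\<Sum>k<r. E k / (of_real \<gamma> + w j - of_real (lam k)))) / of_nat N"
    using il sandwiched_resolvent_index[OF C V z il]
    by (simp add: moment_def dim Let_def E_def flip: w_def)
  also have "\<dots> = (\<Sum>j = 1..N. \<Sum>k<r. w j ^ (p + 1) / (w j - c k) * E k) / of_nat N"
    by (simp add: sum_distrib_left c_def algebra_simps)
  also have "\<dots> = (\<Sum>k<r. (\<Sum>j = 1..N. w j ^ (p + 1) / (w j - c k)) / of_nat N * E k)"
    by (subst sum.swap) (simp add: sum_divide_distrib sum_distrib_right)
  also have "\<dots> = (\<Sum>k<r. (- 1) ^ s * of_real \<rho> ^ N * c k ^ p /
      ((- 1) ^ s * of_real \<rho> ^ N - c k ^ N) * E k)"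
    using quadrature_sum[OF N p pow] by (intro sum.cong) (auto simp: w_def)
  finally show ?thesis by (simp add: c_def E_def)
qed

end

section \<open>The two forms of the filter, and interval matrices\<close>

lemma filter_inside:
  fixes c \<rho> \<sigma> :: real
  assumes "\<rho> \<noteq> 0" "\<sigma> * \<sigma> = 1"
  shows "\<sigma> * \<rho> ^ N * x / (\<sigma> * \<rho> ^ N - c ^ N) = x * (1 / (1 - \<sigma> * (c / \<rho>) ^ N))"
proof -
  define t where "t = \<sigma> * (c / \<rho>) ^ N"
  have "\<sigma> * \<rho> ^ N * t = \<sigma> * \<sigma> * (\<rho> ^ N * (c / \<rho>) ^ N)"
    by (simp only: t_def mult_ac)
  also have "\<dots> = c ^ N"
    using assms by (simp add: power_divide)
  finally have t: "c ^ N = \<sigma> * \<rho> ^ N * t" ..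
  have "\<sigma> * \<rho> ^ N * x / (\<sigma> * \<rho> ^ N - c ^ N) = (\<sigma> * \<rho> ^ N * x) / (\<sigma> * \<rho> ^ N * (1 - t))"
    unfolding t by (simp only: right_diff_distrib mult_1_right)
  \<comment> \<open>Only the cancelled factor has to be nonzero; if \<open>1 - t = 0\<close>, both
    sides are 0 by the convention for division.\<close>
  also have "\<dots> = x / (1 - t)"
    using assms by (intro nonzero_mult_divide_mult_cancel_left) auto
  finally show ?thesis
    by (simp add: t_def)
qed

text \<open>The same function with \<open>c ^ N\<close> instead of
  \<open>\<sigma> * \<rho> ^ N\<close> factored out of the denominator. For \<open>c\<close> outside
  the circle this form shows the decay like the \<open>N\<close>-th power of
  \<open>\<rho> / c\<close>.\<close>

lemma filter_outside:
  fixes c \<rho> \<sigma> :: real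
  assumes "c \<noteq> 0"
  shows "\<sigma> * \<rho> ^ N * x / (\<sigma> * \<rho> ^ N - c ^ N) =
    x * (- (\<sigma> * (\<rho> / c) ^ N) / (1 - \<sigma> * (\<rho> / c) ^ N))"
proof -
  define t where "t = \<sigma> * (\<rho> / c) ^ N"
  have t: "\<sigma> * \<rho> ^ N = c ^ N * t"
    using assms by (simp add: t_def power_divide)
  have "c ^ N * t * x / (c ^ N * t - c ^ N) = (c ^ N * (t * x)) / (c ^ N * (- (1 - t)))"
    by (simp add: algebra_simps)
  also have "\<dots> = t * x / (- (1 - t))"
    using assms by (intro nonzero_mult_divide_mult_cancel_left) simp
  also have "\<dots> = x * (- t / (1 - t))"
    unfolding minus_divide_right[symmetric] by (simp add: mult.commute)
  finally show ?thesis
    by (simp only: t flip: t_def)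
qed

text \<open>\<open>Z - Y\<close> is \<open>- W\<close>, so the entrywise distance equals the
  radius.\<close>

lemma in_interval_mat_add:
  assumes "Z \<in> carrier_mat nr nc" "W \<in> carrier_mat nr nc" "Y = Z + W"
  shows "Z \<in> interval_mat Y (abs_mat W)"
  using assms by (auto simp: interval_mat_def abs_mat_def)

lemma interval_mat_subset_recentre:
  assumes D: "D \<in> carrier_mat nr nc" and D': "D' \<in> carrier_mat nr nc" and R: "R \<in> carrier_mat nr nc"
  shows "interval_mat D R \<subseteq> interval_mat D' (R + abs_mat (D - D'))"
proof
  fix Z assume Z: "Z \<in> interval_mat D R"
  have "cmod (Z $$ (i, l) - D' $$ (i, l)) \<le> R $$ (i, l) + cmod (D $$ (i, l) - D' $$ (i, l))"
    if "i < nr" "l < nc" for i l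
  proof -
    have "cmod (Z $$ (i, l) - D $$ (i, l)) \<le> R $$ (i, l)"
      using Z that D R by (auto simp: interval_mat_def abs_mat_def)
    moreover have "cmod (Z $$ (i, l) - D' $$ (i, l)) \<le>
        cmod (Z $$ (i, l) - D $$ (i, l)) + cmod (D $$ (i, l) - D' $$ (i, l))"
      using norm_triangle_ineq[of "Z $$ (i, l) - D $$ (i, l)" "D $$ (i, l) - D' $$ (i, l)"] by simp
    ultimately show ?thesis by linarith
  qed
  thus "Z \<in> interval_mat D' (R + abs_mat (D - D'))"
    using Z D D' R by (auto simp: interval_mat_def abs_mat_def)
qed

section \<open>Splitting of the quadrature moment and its enclosure\<close>

theorem theorem3p2:
  fixes A B X V C Mt :: "complex mat"
    and lam :: "nat \<Rightarrow> real"
    and a b \<gamma> \<rho> :: real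
    and n r m L M N p s :: nat
  assumes A: "A \<in> carrier_mat n n" "hermitian_mat A"
    and B: "B \<in> carrier_mat n n" "psd_mat B"
    and r: "r = vec_space.rank n B"
    and regular: "regular_pencil A B"
    and weierstrass: "weierstrass_form n r A B X lam"
    and ab: "a < b"
    and endpoints: "\<not> gen_eigenvalue A B (complex_of_real a)"
      "\<not> gen_eigenvalue A B (complex_of_real b)"
    and m: "m \<le> r"
    and inside: "\<And>k. k < m \<Longrightarrow> lam k \<in> {a..b}"
    and outside: "\<And>k. m \<le> k \<Longrightarrow> k < r \<Longrightarrow> lam k \<notin> {a..b}"
    and \<gamma>: "\<gamma> = (b + a) / 2"
    and \<rho>: "\<rho> = (b - a) / 2"
    and pos: "0 < L" "0 < M" "0 < N"
    and V: "V \<in> carrier_mat n L"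
    and V_comb: "C \<in> carrier_mat n L" "V = X * C"
    and p: "p \<in> {0..2 * M - 1}"
    and p_less_N: "p < N"
    and s: "s \<in> {0, 1}"
    and Mt: "Mt \<in> carrier_mat L L"
  shows "moment_in s B V X lam m \<gamma> \<rho> N p
           \<in> interval_mat (moment s A B V \<gamma> \<rho> N p) (abs_mat (moment_out s B V X lam m r \<gamma> \<rho> N p))
       \<and> interval_mat (moment s A B V \<gamma> \<rho> N p) (abs_mat (moment_out s B V X lam m r \<gamma> \<rho> N p))
           \<subseteq> interval_mat Mt (abs_mat (moment_out s B V X lam m r \<gamma> \<rho> N p)
                               + abs_mat (moment s A B V \<gamma> \<rho> N p - Mt))"
proof -
  have "r \<le> n" unfolding r by (rule vec_space.rank_le_nc[OF B(1)])
  then interpret weierstrass_pencil n r A B X lam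
    using A(1) B(1) weierstrass by unfold_locales
  let ?in = "moment_in s B V X lam m \<gamma> \<rho> N p"
  let ?out = "moment_out s B V X lam m r \<gamma> \<rho> N p"
  let ?M = "moment s A B V \<gamma> \<rho> N p"
  have dim: "dim_col V = L" using V by simp
  have carr: "?in \<in> carrier_mat L L" "?out \<in> carrier_mat L L" "?M \<in> carrier_mat L L"
    by (auto simp: moment_in_def moment_out_def moment_def dim)
  have \<rho>_nz: "\<rho> \<noteq> 0" using ab \<rho> by simp
  have sq: "(- 1 :: real) ^ s * (- 1) ^ s = 1" by (simp flip: power_mult_distrib)
  \<comment> \<open>The circle meets the real axis exactly in \<open>a\<close> and \<open>b\<close>,
    which are not eigenvalues.\<close>
  have off_circle: "\<bar>lam k - \<gamma>\<bar> \<noteq> \<bar>\<rho>\<bar>" if "k < r" for k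
  proof
    assume "\<bar>lam k - \<gamma>\<bar> = \<bar>\<rho>\<bar>"
    hence "lam k = a \<or> lam k = b" using ab \<gamma> \<rho> by (auto simp: abs_if field_simps split: if_splits)
    thus False using gen_eigenvalue_lam[OF that] endpoints by auto
  qed
  \<comment> \<open>The centre \<gamma> lies in the interval, so it differs from every outer
    eigenvalue and \<open>\<rho> / (lam k - \<gamma>)\<close> is a genuine quotient.\<close>
  have nonzero: "lam k - \<gamma> \<noteq> 0" if "m \<le> k" "k < r" for k
    using outside[OF that] ab \<gamma> by auto
  have "?M = ?in + ?out"
  proof (rule eq_matI)
    fix i l assume "i < dim_row (?in + ?out)" "l < dim_col (?in + ?out)"
    hence il: "i < L" "l < L" using carr by auto
    let ?t = "\<lambda>k. of_real ((- 1) ^ s * \<rho> ^ N * (lam k - \<gamma>) ^ p / ((- 1) ^ s * \<rho> ^ N - (lam k - \<gamma>) ^ N))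
      * eig_part B V X k $$ (i, l)"
    have "?M $$ (i, l) = (\<Sum>k<r. ?t k)"
      using moment_index[OF V_comb pos(3) p_less_N off_circle il] .
    also have "\<dots> = (\<Sum>k = 0..<m. ?t k) + (\<Sum>k = m..<r. ?t k)"
      using m by (simp add: sum.atLeastLessThan_concat lessThan_atLeast0)
    also have "(\<Sum>k = 0..<m. ?t k) = ?in $$ (i, l)"
      using il by (simp add: moment_in_def dim filter_inside[OF \<rho>_nz sq])
    also have "(\<Sum>k = m..<r. ?t k) = ?out $$ (i, l)"
      using il by (simp add: moment_out_def dim filter_outside[OF nonzero])
    finally show "?M $$ (i, l) = (?in + ?out) $$ (i, l)"
      using carr il by simp
  qed (use carr in auto)
  hence "?in \<in> interval_mat ?M (abs_mat ?out)"
    by (rule in_interval_mat_add[OF carr(1,2)])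
  moreover have "abs_mat ?out \<in> carrier_mat L L" using carr by (simp add: abs_mat_def)
  hence "interval_mat ?M (abs_mat ?out) \<subseteq> interval_mat Mt (abs_mat ?out + abs_mat (?M - Mt))"
    by (rule interval_mat_subset_recentre[OF carr(3) Mt])
  ultimately show ?thesis by blast
qed

end
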